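(* Let $N\ge 2$ and let $f_1,\dots,f_N\in\mathcal{A}(\mathbb{R})$ be such that $(f_1,\dots,f_N)$ is a $c$-conjugate tuple. Let $$\Gamma=\Big\{(x_1,\dots,x_N)\in\mathbb{R}^N\ \Big|\ \sum_{i=1}^N f_i(x_i)=c(x_1,\dots,x_N)\Big\}.$$ Then all of the following assertions hold: (i) there exists $1\le i_0\le N$ such that $\Gamma_{i_0}$ is maximally monotone; (ii) there exists $1\le i_0\le N$ such that $\Gamma_{i_0}=\partial f_{i_0}$; (iii) $\Gamma_i=\partial f_i$ for each $1\le i\le N$; (iv) $\operatorname{Prox}_{f_1}+\cdots+\operatorname{Prox}_{f_N}=\mathrm{Id}$; (v) $e_{f_1^*}+\cdots+e_{f_N^*}=q$; (vi) $\Gamma+\Delta^\perp=\mathbb{R}^N$; (vii) $S(\Gamma)=\mathbb{R}$.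
   Context: $\mathcal{A}(\mathbb{R})$ denotes the set of proper, lower-semicontinuous, convex functions $\mathbb{R}\to\mathbb{R}\cup\{+\infty\}$. $c(x_1,\dots,x_N)=\sum_{1\le i<j\le N}x_ix_j$. $(f_1,\dots,f_N)$ (proper functions) is a $c$-conjugate tuple if for each $1\le i_0\le N$ and every $x_{i_0}$, $$f_{i_0}(x_{i_0})=\Big(\bigoplus_{i\ne i_0}f_i\Big)^c(x_{i_0}):=\sup_{x_i,\ i\neq i_0}\Big(c(x_1,\dots,x_{i_0},\dots,x_N)-\sum_{i\ne i_0}f_i(x_i)\Big).$$ For $1\le i_0\le N$, $\Gamma_{i_0}:\mathbb{R}\to 2^{\mathbb{R}}$ is the set-valued map $\Gamma_{i_0}(x_{i_0})=\{\sum_{i\ne i_0}x_i \mid (x_1,\dots,x_{i_0},\dots,x_N)\in\Gamma\}$. $\partial f$ is the convex subdifferential. $\operatorname{Prox}_f$ is the proximal mapping, $\operatorname{Prox}_f(x)=\operatorname{argmin}_y\,(f(y)+\tfrac12|x-y|^2)$. $\mathrm{Id}$ is the identity map. $q(x)=\tfrac12|x|^2$. $f^*(y)=\sup_x(xy-f(x))$ is the convex conjugate. $e_f(x)=\inf_y\big(f(y)+q(x-y)\big)$ is the Moreau envelope. $\Delta=\{(x,\dots,x)\mid x\in\mathbb{R}\}\subseteq\mathbb{R}^N$ is the diagonal and $\Delta^\perp$ its orthogonal complement. $S(\Gamma)=\{\sum_{i=1}^N x_i\mid(x_1,\dots,x_N)\in\Gamma\}$. *)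

theory Defs
  imports "HOL-Analysis.Analysis"
begin

text \<open>
  The index set \<open>{1, \<dots>, N}\<close> is rendered by a finite linearly ordered type \<open>'n\<close> with
  \<open>N = CARD('n)\<close>, and \<open>\<real>\<^sup>N\<close> by \<open>real ^ 'n\<close>; the order is only used to index the pairs \<open>i < j\<close>.
  Functions into \<open>\<real> \<union> {+\<infinity>}\<close> are \<open>ereal\<close>-valued functions that are required to avoid \<open>-\<infinity>\<close>.
\<close>

definition proper_fun :: "(real \<Rightarrow> ereal) \<Rightarrow> bool" where
  "proper_fun f \<longleftrightarrow> (\<forall>x. f x \<noteq> -\<infinity>) \<and> (\<exists>x. f x \<noteq> \<infinity>)"

definition lsc_fun :: "(real \<Rightarrow> ereal) \<Rightarrow> bool" where
  "lsc_fun f \<longleftrightarrow> (\<forall>x. f x \<le> Liminf (at x) f)"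

text \<open>At \<open>t = 0\<close> and \<open>t = 1\<close> the convention \<open>0 * \<infinity> = 0\<close> of \<open>ereal\<close> makes the inequality trivial.\<close>

definition convex_fun :: "(real \<Rightarrow> ereal) \<Rightarrow> bool" where
  "convex_fun f \<longleftrightarrow> (\<forall>x y. \<forall>t\<in>{0..1}.
     f ((1 - t) * x + t * y) \<le> ereal (1 - t) * f x + ereal t * f y)"

definition class_A :: "(real \<Rightarrow> ereal) set" where
  "class_A = {f. proper_fun f \<and> lsc_fun f \<and> convex_fun f}"

definition cost :: "real ^ ('n :: {finite, linorder}) \<Rightarrow> real" where
  "cost x = (\<Sum>(i, j)\<in>{(i, j). i < j}. x $ i * x $ j)"

definition c_conjugate ::
    "('n :: {finite, linorder} \<Rightarrow> real \<Rightarrow> ereal) \<Rightarrow> 'n \<Rightarrow> real \<Rightarrow> ereal" where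
  "c_conjugate f i\<^sub>0 t =
     (SUP x\<in>{x :: real ^ ('n :: {finite, linorder}). x $ i\<^sub>0 = t}. ereal (cost x) - (\<Sum>i\<in>UNIV - {i\<^sub>0}. f i (x $ i)))"

definition c_conjugate_tuple :: "('n :: {finite, linorder} \<Rightarrow> real \<Rightarrow> ereal) \<Rightarrow> bool" where
  "c_conjugate_tuple f \<longleftrightarrow>
     (\<forall>i. proper_fun (f i)) \<and> (\<forall>i\<^sub>0 t. f i\<^sub>0 t = c_conjugate f i\<^sub>0 t)"

definition contact_set ::
    "('n :: {finite, linorder} \<Rightarrow> real \<Rightarrow> ereal) \<Rightarrow> (real ^ ('n :: {finite, linorder})) set" where
  "contact_set f = {x. (\<Sum>i\<in>UNIV. f i (x $ i)) = ereal (cost x)}"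

definition marginal_map :: "(real ^ 'n) set \<Rightarrow> 'n :: finite \<Rightarrow> real \<Rightarrow> real set" where
  "marginal_map \<Gamma> i\<^sub>0 t = {\<Sum>i\<in>UNIV - {i\<^sub>0}. x $ i | x. x \<in> \<Gamma> \<and> x $ i\<^sub>0 = t}"

definition sum_set :: "(real ^ 'n :: finite) set \<Rightarrow> real set" where
  "sum_set \<Gamma> = {\<Sum>i\<in>UNIV. x $ i | x. x \<in> \<Gamma>}"

definition monotone_map :: "(real \<Rightarrow> real set) \<Rightarrow> bool" where
  "monotone_map A \<longleftrightarrow> (\<forall>x y. \<forall>u\<in>A x. \<forall>v\<in>A y. (x - y) * (u - v) \<ge> 0)"

definition maximally_monotone :: "(real \<Rightarrow> real set) \<Rightarrow> bool" where
  "maximally_monotone A \<longleftrightarrow>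
     monotone_map A \<and> (\<forall>B. monotone_map B \<and> (\<forall>x. A x \<subseteq> B x) \<longrightarrow> B = A)"

text \<open>For proper \<open>f\<close> this is empty wherever \<open>f x = \<infinity>\<close>, as usual.\<close>

definition subdiff :: "(real \<Rightarrow> ereal) \<Rightarrow> real \<Rightarrow> real set" where
  "subdiff f x = {u. \<forall>y. f x + ereal (u * (y - x)) \<le> f y}"

definition q :: "real \<Rightarrow> real" where
  "q x = \<bar>x\<bar>\<^sup>2 / 2"

text \<open>
  The proximal mapping is the full set of minimisers, not a choice of one. An equation between
  a Minkowski sum of such sets and a singleton thus includes existence and uniqueness of
  each minimiser.
\<close>

definition Prox :: "(real \<Rightarrow> ereal) \<Rightarrow> real \<Rightarrow> real set" where
  "Prox f x = {y. is_arg_min (\<lambda>y. f y + ereal (\<bar>x - y\<bar>\<^sup>2 / 2)) (\<lambda>_. True) y}"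

definition convex_conjugate :: "(real \<Rightarrow> ereal) \<Rightarrow> real \<Rightarrow> ereal" where
  "convex_conjugate f y = (SUP x. ereal (x * y) - f x)"

definition moreau_env :: "(real \<Rightarrow> ereal) \<Rightarrow> real \<Rightarrow> ereal" where
  "moreau_env f x = (INF y. f y + ereal (q (x - y)))"

definition diagonal :: "(real ^ 'n :: finite) set" where
  "diagonal = {\<chi> i. t | t. True}"

end

theory Submission
  imports Defs
begin

text \<open>
  Write \<open>c(x) = (s\<^sup>2 - \<Sum> x\<^sub>i\<^sup>2) / 2\<close> with \<open>s = \<Sum> x\<^sub>i\<close>, and let \<open>P\<^sub>i = (Id + \<partial>f\<^sub>i)\<inverse>\<close> be the
  resolvent of \<open>f\<^sub>i\<close>. Conjugacy makes every \<open>f\<^sub>i\<close> a supremum of affine functions, so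
  \<open>P\<^sub>i\<close> is defined on the whole line, nondecreasing and nonexpansive. All assertions follow once
  \<open>P(s) = (P\<^sub>1(s), \<dots>, P\<^sub>N(s))\<close> lies in \<open>\<Gamma>\<close> and has sum \<open>s\<close>, for every real \<open>s\<close>.

  Put \<open>G(x) = \<Sum> f\<^sub>i(x\<^sub>i) - c(x) \<ge> 0\<close>. Adding the subgradient inequalities at the points
  \<open>P\<^sub>i(s)\<close> gives, for every tuple \<open>x\<close> in the domains with sum \<open>s\<close>,
  \<open>G(x) \<ge> \<delta>(s) + \<Sum> (x\<^sub>i - P\<^sub>i(s))\<^sup>2 / 2\<close>, where
  \<open>\<delta>(s) = G(P(s)) + (s - \<Sum> P\<^sub>i(s))\<^sup>2 / 2 \<ge> 0\<close> (\<open>defect_le_gap\<close>). What is wanted is \<open>\<delta> = 0\<close>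
  everywhere.

  Conjugacy provides, for each \<open>t\<close> in the domain of \<open>f\<^sub>i\<close>, tuples with \<open>x\<^sub>i = t\<close> and \<open>G(x)\<close>
  arbitrarily small; so \<open>\<delta>(s)\<close> and \<open>t - P\<^sub>i(s)\<close> can be made small simultaneously. If
  \<open>P\<^sub>i(a) < t < P\<^sub>i(b)\<close>, monotonicity confines such \<open>s\<close> to \<open>[a, b]\<close>, and compactness yields a
  zero of \<open>\<delta>\<close> in \<open>(a, b)\<close> (\<open>zero_defect_between\<close>). Hence on every interval without zeros
  of \<open>\<delta>\<close> all \<open>P\<^sub>i\<close> are constant. On an unbounded such interval this would bound all domains
  on one side, and then the conjugacy formula would make \<open>f\<^sub>i\<close> finite beyond its own bound
  (\<open>zero_defect_beyond\<close>). On a bounded one, with endpoints \<open>a < b\<close> that are zeros of \<open>\<delta>\<close>, it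
  would give \<open>a = \<Sum> P\<^sub>i(a) = \<Sum> P\<^sub>i(b) = b\<close> (\<open>zero_defect\<close>).
\<close>

section \<open>The resolvent of a convex function on the line\<close>

text \<open>
  Surjectivity of \<open>Id + \<partial>\<phi>\<close> (Minty), for a real function \<open>\<phi>\<close> on its effective domain
  \<open>D\<close>. Lower semicontinuity is expressed by the closed epigraph.
\<close>

lemma resolvent_exists:
  fixes \<phi> :: "real \<Rightarrow> real"
  assumes ne: "D \<noteq> {}" and conv: "convex_on D \<phi>" and cl: "closed (epigraph D \<phi>)"
    and minorant: "\<And>y. y \<in> D \<Longrightarrow> a * y + b \<le> \<phi> y"
  shows "\<exists>p\<in>D. \<forall>y\<in>D. \<phi> p + (s - p) * (y - p) \<le> \<phi> y"
proof -
  obtain y0 where y0: "y0 \<in> D" using ne by blast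
  define g where "g = (\<lambda>z :: real \<times> real. snd z + (s - fst z)\<^sup>2 / 2)"
  define M where "M = \<phi> y0 + (s - y0)\<^sup>2 / 2"
  define K where "K = epigraph D \<phi> \<inter> {z. g z \<le> M}"
  define R where "R = 2 * (M - b - a * s) + a\<^sup>2"
  have g_cont: "continuous_on UNIV g"
    unfolding g_def by (intro continuous_intros) auto
  \<comment> \<open>the affine minorant keeps the sublevel set \<open>K\<close> inside a rectangle\<close>
  have "K \<subseteq> {s - a - (R + 1)..s - a + (R + 1)} \<times> {- \<bar>a\<bar> * (\<bar>s - a\<bar> + (R + 1)) + b..M}"
  proof
    fix z assume "z \<in> K"
    then obtain y r where z: "z = (y, r)" and y: "y \<in> D" and r: "\<phi> y \<le> r"
      and le: "r + (s - y)\<^sup>2 / 2 \<le> M"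
      by (cases z) (auto simp: K_def epigraph_def g_def)
    have ay: "a * y + b \<le> r" using minorant[OF y] r by linarith
    have "(y - (s - a))\<^sup>2 = 2 * ((s - y)\<^sup>2 / 2 + a * y - a * s) + a\<^sup>2"
      by (simp add: power2_eq_square field_simps)
    also have "\<dots> \<le> R"
    proof -
      have "(s - y)\<^sup>2 / 2 + a * y - a * s \<le> M - b - a * s" using le ay by simp
      then show ?thesis by (simp add: R_def)
    qed
    finally have sq: "(y - (s - a))\<^sup>2 \<le> R" .
    have "\<bar>v\<bar> \<le> v\<^sup>2 + 1" for v :: real
    proof -
      have "0 \<le> (\<bar>v\<bar> - 1)\<^sup>2" by simp
      also have "\<dots> = v\<^sup>2 - 2 * \<bar>v\<bar> + 1" by (simp add: power2_diff)
      finally show ?thesis using abs_ge_zero[of v] by linarith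
    qed
    from this[of "y - (s - a)"] sq have yb: "\<bar>y - (s - a)\<bar> \<le> R + 1" by linarith
    have "\<bar>a * y\<bar> \<le> \<bar>a\<bar> * (\<bar>s - a\<bar> + (R + 1))"
      unfolding abs_mult by (rule mult_left_mono) (use yb in linarith, simp)
    then have "- \<bar>a\<bar> * (\<bar>s - a\<bar> + (R + 1)) + b \<le> r" using ay by (simp add: abs_le_iff)
    moreover have "r \<le> M" using le zero_le_power2[of "s - y"] by linarith
    ultimately show "z \<in> {s - a - (R + 1)..s - a + (R + 1)} \<times> {- \<bar>a\<bar> * (\<bar>s - a\<bar> + (R + 1)) + b..M}"
      using yb z by (auto simp: abs_le_iff)
  qed
  then have "bounded K"
    by (rule bounded_subset[rotated]) (intro bounded_Times bounded_closed_interval)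
  moreover have "closed K"
    unfolding K_def by (intro closed_Int cl closed_Collect_le g_cont) auto
  ultimately have "compact K" by (simp add: compact_eq_bounded_closed)
  moreover have "(y0, \<phi> y0) \<in> K" using y0 by (auto simp: K_def epigraph_def g_def M_def)
  ultimately obtain z where z: "z \<in> K" and min: "\<And>w. w \<in> K \<Longrightarrow> g z \<le> g w"
    using continuous_attains_inf[of K g, OF _ _ continuous_on_subset[OF g_cont subset_UNIV]] by blast
  define p where "p = fst z"
  have p: "p \<in> D" and \<phi>p: "\<phi> p \<le> snd z" using z by (auto simp: K_def epigraph_def p_def)
  have gz: "g z \<le> M" using z by (simp add: K_def)
  have opt: "\<phi> p + (s - p)\<^sup>2 / 2 \<le> \<phi> y + (s - y)\<^sup>2 / 2" if y: "y \<in> D" for y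
  proof (cases "\<phi> y + (s - y)\<^sup>2 / 2 \<le> M")
    case True
    then have "(y, \<phi> y) \<in> K" using y by (auto simp: K_def epigraph_def g_def)
    from min[OF this] show ?thesis using \<phi>p by (simp add: g_def p_def)
  next
    case False
    then show ?thesis using gz \<phi>p by (simp add: g_def p_def)
  qed
  have "\<phi> p + (s - p) * (y - p) \<le> \<phi> y" if y: "y \<in> D" for y
  proof -
    \<comment> \<open>compare \<open>p\<close> with \<open>p + t (y - p)\<close>, divide by \<open>t\<close> and let \<open>t\<close> tend to \<open>0\<close>\<close>
    have lin: "\<phi> p + (s - p) * (y - p) - \<phi> y \<le> t * ((y - p)\<^sup>2 / 2)" if t: "0 < t" "t < 1" for t
    proof -
      define w where "w = (1 - t) * p + t * y"
      have "w \<in> D"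
        using convexD_alt[OF convex_on_imp_convex[OF conv] p y, of t] t by (simp add: w_def)
      from opt[OF this] have "\<phi> p + (s - p)\<^sup>2 / 2 \<le> \<phi> w + (s - w)\<^sup>2 / 2" .
      also have "\<phi> w \<le> (1 - t) * \<phi> p + t * \<phi> y"
        using convex_onD[OF conv, of t p y] t p y by (simp add: w_def)
      finally have "0 \<le> t * (\<phi> y - \<phi> p) + ((s - w)\<^sup>2 - (s - p)\<^sup>2) / 2"
        by (simp add: field_simps)
      also have "\<dots> = t * (\<phi> y - \<phi> p - (s - p) * (y - p) + t * ((y - p)\<^sup>2 / 2))"
        by (simp add: w_def power2_eq_square field_simps)
      finally show ?thesis using t by (simp add: zero_le_mult_iff)
    qed
    have "((\<lambda>t. t * ((y - p)\<^sup>2 / 2)) \<longlongrightarrow> 0 * ((y - p)\<^sup>2 / 2)) (at_right 0)"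
      by (intro tendsto_intros)
    moreover have "eventually (\<lambda>t. \<phi> p + (s - p) * (y - p) - \<phi> y \<le> t * ((y - p)\<^sup>2 / 2)) (at_right 0)"
      by (rule eventually_mono[OF eventually_at_right_real[OF zero_less_one]]) (rule lin, auto)
    ultimately have "\<phi> p + (s - p) * (y - p) - \<phi> y \<le> 0 * ((y - p)\<^sup>2 / 2)"
      by (rule tendsto_lowerbound) simp
    then show ?thesis by simp
  qed
  then show ?thesis using p by blast
qed


section \<open>Real tuples conjugate with respect to the pairwise cost\<close>

text \<open>
  The sum of the products \<open>x\<^sub>i x\<^sub>j\<close> over unordered pairs, in the form that needs no order on the
  indices.
\<close>

definition pair_cost :: "('n :: finite \<Rightarrow> real) \<Rightarrow> real" where
  "pair_cost x = ((\<Sum>i\<in>UNIV. x i)\<^sup>2 - (\<Sum>i\<in>UNIV. (x i)\<^sup>2)) / 2"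

lemma pair_cost_upd:
  "pair_cost (x(i := t)) = pair_cost (x(i := t')) + (t - t') * (\<Sum>j\<in>UNIV - {i}. x j)"
proof -
  have s: "(\<Sum>k\<in>UNIV. (x(i := r)) k) = r + (\<Sum>j\<in>UNIV - {i}. x j)" for r
    by (subst sum.remove[of _ i]) auto
  have s2: "(\<Sum>k\<in>UNIV. ((x(i := r)) k)\<^sup>2) = r\<^sup>2 + (\<Sum>j\<in>UNIV - {i}. (x j)\<^sup>2)" for r
    by (subst sum.remove[of _ i]) auto
  show ?thesis
    unfolding pair_cost_def s s2 by (simp add: power2_eq_square field_simps)
qed

text \<open>
  Conjugate tuples in terms of real values: \<open>\<phi>\<^sub>i\<close> is the finite part of \<open>f\<^sub>i\<close> on its effective domain
  \<open>D\<^sub>i\<close>. The last two assumptions say that the extension of \<open>\<phi>\<^sub>i\<close> by \<open>\<infinity>\<close> is at least, and at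
  most, the conjugate of the other functions; the values of \<open>\<phi>\<^sub>i\<close> off \<open>D\<^sub>i\<close> are irrelevant.
\<close>

locale conjugate_tuple =
  fixes D :: "'n :: finite \<Rightarrow> real set" and \<phi> :: "'n \<Rightarrow> real \<Rightarrow> real"
  assumes dom_nonempty: "D i \<noteq> {}"
    and pair_cost_le: "(\<And>i. x i \<in> D i) \<Longrightarrow> pair_cost x \<le> (\<Sum>i\<in>UNIV. \<phi> i (x i))"
    and least: "(\<And>x. x i = t \<Longrightarrow> (\<And>j. j \<noteq> i \<Longrightarrow> x j \<in> D j) \<Longrightarrow>
        pair_cost x - (\<Sum>j\<in>UNIV - {i}. \<phi> j (x j)) \<le> r) \<Longrightarrow> t \<in> D i \<and> \<phi> i t \<le> r"
begin

text \<open>Each \<open>\<phi>\<^sub>i\<close> dominates the affine functions whose supremum it is.\<close>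

lemma affine_le:
  assumes t: "t \<in> D i" and x: "\<And>j. j \<noteq> i \<Longrightarrow> x j \<in> D j"
  shows "pair_cost (x(i := t)) - (\<Sum>j\<in>UNIV - {i}. \<phi> j (x j)) \<le> \<phi> i t"
proof -
  have "pair_cost (x(i := t)) \<le> (\<Sum>k\<in>UNIV. \<phi> k ((x(i := t)) k))"
    by (rule pair_cost_le) (use t x in auto)
  also have "\<dots> = \<phi> i t + (\<Sum>j\<in>UNIV - {i}. \<phi> j (x j))"
    by (subst sum.remove[of _ i]) auto
  finally show ?thesis by simp
qed

lemma convex_on_dom: "convex_on (D i) (\<phi> i)"
proof -
  have *: "(1 - l) * t + l * t' \<in> D i \<and> \<phi> i ((1 - l) * t + l * t') \<le> (1 - l) * \<phi> i t + l * \<phi> i t'"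
    if t: "t \<in> D i" "t' \<in> D i" and l: "0 \<le> l" "l \<le> 1" for t t' l
  proof (rule least)
    fix x assume xi: "x i = (1 - l) * t + l * t'" and x: "\<And>j. j \<noteq> i \<Longrightarrow> x j \<in> D j"
    define A where "A = (\<Sum>j\<in>UNIV - {i}. \<phi> j (x j))"
    have "pair_cost x = pair_cost (x(i := (1 - l) * t + l * t'))"
      using xi by (simp add: fun_upd_idem)
    also have "\<dots> = (1 - l) * pair_cost (x(i := t)) + l * pair_cost (x(i := t'))"
      unfolding pair_cost_upd[of x i "(1 - l) * t + l * t'" t'] pair_cost_upd[of x i t t']
      by (simp add: algebra_simps)
    also have "\<dots> - A = (1 - l) * (pair_cost (x(i := t)) - A) + l * (pair_cost (x(i := t')) - A)"
      by (simp add: algebra_simps)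
    also have "\<dots> \<le> (1 - l) * \<phi> i t + l * \<phi> i t'"
      unfolding A_def using affine_le[OF t(1) x] affine_le[OF t(2) x] l
      by (intro add_mono mult_left_mono) auto
    finally show "pair_cost x - (\<Sum>j\<in>UNIV - {i}. \<phi> j (x j)) \<le> (1 - l) * \<phi> i t + l * \<phi> i t'"
      by (simp add: A_def)
  qed
  have "convex (D i)" unfolding convex_alt using * by auto
  then show ?thesis using * by (intro convex_onI) auto
qed

lemma closed_epigraph: "closed (epigraph (D i) (\<phi> i))"
  unfolding closed_sequential_limits
proof (intro allI impI, elim conjE)
  fix z :: "nat \<Rightarrow> real \<times> real" and l
  assume z: "\<forall>n. z n \<in> epigraph (D i) (\<phi> i)" and lim: "z \<longlonglongrightarrow> l"
  have "fst l \<in> D i \<and> \<phi> i (fst l) \<le> snd l"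
  proof (rule least)
    fix x assume xi: "x i = fst l" and x: "\<And>j. j \<noteq> i \<Longrightarrow> x j \<in> D j"
    define A where "A = (\<Sum>j\<in>UNIV - {i}. \<phi> j (x j))"
    have up: "pair_cost (x(i := t)) = pair_cost x + (t - fst l) * (\<Sum>j\<in>UNIV - {i}. x j)" for t
      using pair_cost_upd[of x i t "fst l"] xi by (simp add: fun_upd_idem)
    have "pair_cost x + (fst (z n) - fst l) * (\<Sum>j\<in>UNIV - {i}. x j) - A \<le> snd (z n)" for n
    proof -
      have "fst (z n) \<in> D i" "\<phi> i (fst (z n)) \<le> snd (z n)"
        using z by (auto simp: epigraph_def)
      then show ?thesis using affine_le[where i = i, OF _ x, of "fst (z n)"] up[of "fst (z n)"] A_def by simp
    qed
    moreover have "(\<lambda>n. pair_cost x + (fst (z n) - fst l) * (\<Sum>j\<in>UNIV - {i}. x j) - A)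
        \<longlonglongrightarrow> pair_cost x + (fst l - fst l) * (\<Sum>j\<in>UNIV - {i}. x j) - A"
      by (intro tendsto_intros tendsto_fst lim)
    moreover have "(\<lambda>n. snd (z n)) \<longlonglongrightarrow> snd l" by (intro tendsto_intros lim)
    ultimately have "pair_cost x + (fst l - fst l) * (\<Sum>j\<in>UNIV - {i}. x j) - A \<le> snd l"
      by (intro LIMSEQ_le) auto
    then show "pair_cost x - (\<Sum>j\<in>UNIV - {i}. \<phi> j (x j)) \<le> snd l" by (simp add: A_def)
  qed
  then show "l \<in> epigraph (D i) (\<phi> i)" by (simp add: epigraph_def)
qed

text \<open>
  The resolvent \<open>(Id + \<partial>\<phi>\<^sub>i)\<inverse>\<close>: the point \<open>p\<close> at which \<open>s - p\<close> is a subgradient. It exists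
  by \<open>resolvent_exists\<close> and is unique by \<open>resolvent_eqI\<close> below.
\<close>

definition resolvent :: "'n \<Rightarrow> real \<Rightarrow> real" where
  "resolvent i s = (SOME p. p \<in> D i \<and> (\<forall>y\<in>D i. \<phi> i p + (s - p) * (y - p) \<le> \<phi> i y))"

lemma
  shows resolvent_in_dom: "resolvent i s \<in> D i"
    and resolvent_subgradient:
      "y \<in> D i \<Longrightarrow> \<phi> i (resolvent i s) + (s - resolvent i s) * (y - resolvent i s) \<le> \<phi> i y"
proof -
  define x where "x = (\<lambda>j. SOME t. t \<in> D j)"
  have x: "x j \<in> D j" for j using dom_nonempty[of j] by (auto simp: x_def intro: someI)
  have "(\<Sum>j\<in>UNIV - {i}. x j) * y + (pair_cost (x(i := 0)) - (\<Sum>j\<in>UNIV - {i}. \<phi> j (x j))) \<le> \<phi> i y"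
    if "y \<in> D i" for y
    using affine_le[OF that, of x] x pair_cost_upd[of x i y 0] by (simp add: mult.commute)
  from resolvent_exists[OF dom_nonempty convex_on_dom closed_epigraph this, of s]
  have "\<exists>p. p \<in> D i \<and> (\<forall>y\<in>D i. \<phi> i p + (s - p) * (y - p) \<le> \<phi> i y)" by blast
  then have "resolvent i s \<in> D i \<and> (\<forall>y\<in>D i. \<phi> i (resolvent i s)
      + (s - resolvent i s) * (y - resolvent i s) \<le> \<phi> i y)"
    unfolding resolvent_def by (rule someI_ex)
  then show "resolvent i s \<in> D i"
    and "y \<in> D i \<Longrightarrow> \<phi> i (resolvent i s) + (s - resolvent i s) * (y - resolvent i s) \<le> \<phi> i y"
    by auto
qed

lemma subgradient_firmly_nonexpansive:
  assumes "p \<in> D i" "\<And>y. y \<in> D i \<Longrightarrow> \<phi> i p + (s - p) * (y - p) \<le> \<phi> i y"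
  shows "(p - resolvent i s')\<^sup>2 \<le> (s - s') * (p - resolvent i s')"
  using assms(2)[OF resolvent_in_dom[of i s']] resolvent_subgradient[OF assms(1), of s']
  by (simp add: power2_eq_square algebra_simps)

lemma resolvent_eqI:
  assumes "p \<in> D i" "\<And>y. y \<in> D i \<Longrightarrow> \<phi> i p + (s - p) * (y - p) \<le> \<phi> i y"
  shows "resolvent i s = p"
  using subgradient_firmly_nonexpansive[OF assms, of s] by simp

lemma resolvent_firmly_nonexpansive:
  "(resolvent i s - resolvent i s')\<^sup>2 \<le> (s - s') * (resolvent i s - resolvent i s')"
  by (rule subgradient_firmly_nonexpansive) (auto intro: resolvent_in_dom resolvent_subgradient)

lemma resolvent_mono: "s \<le> s' \<Longrightarrow> resolvent i s \<le> resolvent i s'"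
proof (rule ccontr)
  assume "s \<le> s'" "\<not> resolvent i s \<le> resolvent i s'"
  then have "(s - s') * (resolvent i s - resolvent i s') \<le> 0"
    and "0 < (resolvent i s - resolvent i s')\<^sup>2"
    by (auto simp: mult_le_0_iff)
  then show False using resolvent_firmly_nonexpansive[of i s s'] by linarith
qed

lemma resolvent_lipschitz: "\<bar>resolvent i s - resolvent i s'\<bar> \<le> \<bar>s - s'\<bar>"
proof -
  let ?d = "resolvent i s - resolvent i s'"
  have "\<bar>?d\<bar> * \<bar>?d\<bar> \<le> \<bar>s - s'\<bar> * \<bar>?d\<bar>"
    using resolvent_firmly_nonexpansive[of i s s'] abs_ge_self[of "(s - s') * ?d"]
    by (simp add: power2_eq_square abs_mult)
  then show ?thesis
    using mult_right_le_imp_le[of "\<bar>?d\<bar>" "\<bar>?d\<bar>" "\<bar>s - s'\<bar>"] by (cases "?d = 0") auto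
qed

lemma continuous_resolvent: "continuous_on UNIV (resolvent i)"
proof (rule lipschitz_on_continuous_on)
  show "1-lipschitz_on UNIV (resolvent i)"
    using resolvent_lipschitz by (intro lipschitz_onI) (auto simp: dist_real_def)
qed

lemma continuous_\<phi>_resolvent: "continuous_on UNIV (\<lambda>s. \<phi> i (resolvent i s))"
proof -
  have le: "\<bar>\<phi> i (resolvent i s) - \<phi> i (resolvent i s')\<bar>
      \<le> (\<bar>s - resolvent i s\<bar> + \<bar>s' - resolvent i s'\<bar>) * \<bar>s - s'\<bar>" for s s'
  proof -
    have 1: "\<phi> i (resolvent i t) - \<phi> i (resolvent i t') \<le> \<bar>t - resolvent i t\<bar> * \<bar>t - t'\<bar>" for t t'
    proof -
      have "\<phi> i (resolvent i t) - \<phi> i (resolvent i t')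
          \<le> (t - resolvent i t) * (resolvent i t - resolvent i t')"
        using resolvent_subgradient[OF resolvent_in_dom, of i t t'] by (simp add: algebra_simps)
      also have "\<dots> \<le> \<bar>t - resolvent i t\<bar> * \<bar>resolvent i t - resolvent i t'\<bar>"
        by (metis abs_ge_self abs_mult)
      also have "\<dots> \<le> \<bar>t - resolvent i t\<bar> * \<bar>t - t'\<bar>"
        by (intro mult_left_mono resolvent_lipschitz) auto
      finally show ?thesis .
    qed
    have "0 \<le> \<bar>s - resolvent i s\<bar> * \<bar>s - s'\<bar>" "0 \<le> \<bar>s' - resolvent i s'\<bar> * \<bar>s - s'\<bar>" by simp_all
    then show ?thesis
      using 1[of s s'] 1[of s' s, unfolded abs_minus_commute[of s' s]]
      unfolding distrib_right by linarith
  qed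
  have "isCont (\<lambda>s. \<phi> i (resolvent i s)) s" for s
  proof -
    have r: "(resolvent i \<longlongrightarrow> resolvent i s) (at s)"
      using continuous_resolvent[of i] by (simp add: continuous_on_def)
    have "((\<lambda>t. (\<bar>t - resolvent i t\<bar> + \<bar>s - resolvent i s\<bar>) * \<bar>t - s\<bar>) \<longlongrightarrow>
        (\<bar>s - resolvent i s\<bar> + \<bar>s - resolvent i s\<bar>) * \<bar>s - s\<bar>) (at s)"
      by (intro tendsto_intros r)
    then have "((\<lambda>t. \<phi> i (resolvent i t) - \<phi> i (resolvent i s)) \<longlongrightarrow> 0) (at s)"
      by (intro Lim_null_comparison[OF eventuallyI[of "\<lambda>t. norm (\<phi> i (resolvent i t) - \<phi> i (resolvent i s))
          \<le> (\<bar>t - resolvent i t\<bar> + \<bar>s - resolvent i s\<bar>) * \<bar>t - s\<bar>"]]) (simp_all add: le)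
    then show ?thesis by (simp add: isCont_def LIM_zero_iff)
  qed
  then show ?thesis by (simp add: continuous_on_eq_continuous_at)
qed

text \<open>The function \<open>G\<close> of the introduction; among tuples in the domains, its zeros form the contact set.\<close>

definition gap :: "('n \<Rightarrow> real) \<Rightarrow> real" where
  "gap x = (\<Sum>i\<in>UNIV. \<phi> i (x i)) - pair_cost x"

lemma gap_nonneg: "(\<And>i. x i \<in> D i) \<Longrightarrow> 0 \<le> gap x"
  using pair_cost_le by (simp add: gap_def)

text \<open>
  The function \<open>\<delta>\<close> of the introduction. It vanishes iff the tuple of resolvents at \<open>s\<close> is in the
  contact set and has sum \<open>s\<close>.
\<close>

definition defect :: "real \<Rightarrow> real" where
  "defect s = gap (\<lambda>i. resolvent i s) + (s - (\<Sum>i\<in>UNIV. resolvent i s))\<^sup>2 / 2"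

lemma gap_resolvent_nonneg: "0 \<le> gap (\<lambda>i. resolvent i s)"
  by (rule gap_nonneg) (rule resolvent_in_dom)

lemma defect_nonneg: "0 \<le> defect s"
  using gap_resolvent_nonneg by (simp add: defect_def)

lemma continuous_defect: "continuous_on UNIV defect"
  unfolding defect_def gap_def pair_cost_def
  by (intro continuous_intros continuous_resolvent continuous_\<phi>_resolvent) auto

text \<open>
  The central estimate: a tuple whose gap is small has a sum \<open>s\<close> of small defect, and is itself
  close to the tuple of resolvents at \<open>s\<close>.
\<close>

lemma defect_le_gap:
  assumes x: "\<And>i. x i \<in> D i" and s: "s = (\<Sum>i\<in>UNIV. x i)"
  shows "defect s + (\<Sum>i\<in>UNIV. (x i - resolvent i s)\<^sup>2) / 2 \<le> gap x"
proof -
  let ?p = "\<lambda>i. resolvent i s"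
  define \<sigma> where "\<sigma> = (\<Sum>i\<in>UNIV. ?p i)"
  have "(\<Sum>i\<in>UNIV. \<phi> i (?p i) + (s - ?p i) * (x i - ?p i)) \<le> (\<Sum>i\<in>UNIV. \<phi> i (x i))"
    by (intro sum_mono resolvent_subgradient x)
  also have "(\<Sum>i\<in>UNIV. \<phi> i (?p i) + (s - ?p i) * (x i - ?p i))
      = (\<Sum>i\<in>UNIV. \<phi> i (?p i) + s * x i - s * ?p i
          + ((x i - ?p i)\<^sup>2 / 2 - (x i)\<^sup>2 / 2 + (?p i)\<^sup>2 / 2))"
    by (intro sum.cong) (auto simp: power2_eq_square field_simps)
  also have "\<dots> = (\<Sum>i\<in>UNIV. \<phi> i (?p i)) + s * s - s * \<sigma>
      + ((\<Sum>i\<in>UNIV. (x i - ?p i)\<^sup>2) / 2 - (\<Sum>i\<in>UNIV. (x i)\<^sup>2) / 2 + (\<Sum>i\<in>UNIV. (?p i)\<^sup>2) / 2)"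
    by (simp add: sum.distrib sum_subtractf s \<sigma>_def flip: sum_distrib_left sum_divide_distrib)
  finally show ?thesis
    unfolding defect_def gap_def pair_cost_def s[symmetric] \<sigma>_def[symmetric]
    by (simp add: power2_eq_square field_simps)
qed

text \<open>
  The only property of a domain point \<open>t\<close> used here is that \<open>\<phi>\<^sub>i t\<close> is the least upper bound in the
  conjugacy formula; the supremum need not be attained.
\<close>

lemma approx_contact:
  assumes t: "t \<in> D i" and e: "0 < e"
  shows "\<exists>s. defect s + (t - resolvent i s)\<^sup>2 / 2 < e"
proof (rule ccontr)
  assume "\<not> ?thesis"
  then have no: "e \<le> defect s + (t - resolvent i s)\<^sup>2 / 2" for s by (simp add: not_less)
  have "t \<in> D i \<and> \<phi> i t \<le> \<phi> i t - e"
  proof (rule least)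
    fix x assume xi: "x i = t" and x: "\<And>j. j \<noteq> i \<Longrightarrow> x j \<in> D j"
    define s where "s = (\<Sum>j\<in>UNIV. x j)"
    have xD: "x j \<in> D j" for j using t x xi by (cases "j = i") auto
    have "e \<le> defect s + (x i - resolvent i s)\<^sup>2 / 2" using no[of s] xi by simp
    also have "(x i - resolvent i s)\<^sup>2 \<le> (\<Sum>j\<in>UNIV. (x j - resolvent j s)\<^sup>2)"
      by (rule member_le_sum) auto
    finally have "e \<le> gap x" using defect_le_gap[of x s, OF xD s_def] by simp
    moreover have "gap x = \<phi> i t + (\<Sum>j\<in>UNIV - {i}. \<phi> j (x j)) - pair_cost x"
      unfolding gap_def by (subst sum.remove[of _ i]) (auto simp: xi)
    ultimately show "pair_cost x - (\<Sum>j\<in>UNIV - {i}. \<phi> j (x j)) \<le> \<phi> i t - e" by simp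
  qed
  then show False using e by simp
qed

lemma zero_defect_between:
  assumes lt: "resolvent i a < resolvent i b"
  shows "\<exists>s. a < s \<and> s < b \<and> defect s = 0"
proof -
  define t where "t = (resolvent i a + resolvent i b) / 2"
  have t: "resolvent i a < t" "t < resolvent i b" using lt by (auto simp: t_def)
  have tD: "t \<in> D i"
    using convexD_alt[OF convex_on_imp_convex[OF convex_on_dom] resolvent_in_dom resolvent_in_dom,
        of "1/2" i a b] by (simp add: t_def field_simps)
  define e where "e = (\<lambda>s. defect s + (t - resolvent i s)\<^sup>2 / 2)"
  have ab: "a < b" using lt resolvent_mono[of b a i] by (meson not_le)
  have "continuous_on {a..b} e"
    unfolding e_def
    by (intro continuous_intros continuous_on_subset[OF continuous_defect]
        continuous_on_subset[OF continuous_resolvent]) auto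
  then obtain s where s: "s \<in> {a..b}" and min: "\<And>s'. s' \<in> {a..b} \<Longrightarrow> e s \<le> e s'"
    using continuous_attains_inf[of "{a..b}" e] ab by auto
  have "e s = 0"
  proof (rule ccontr)
    \<comment> \<open>otherwise some \<open>s'\<close> has a smaller value of \<open>e\<close>, so small that monotonicity forces \<open>s'\<close> into \<open>[a, b]\<close>\<close>
    assume "e s \<noteq> 0"
    then have "0 < e s"
      using defect_nonneg[of s] by (simp add: e_def less_le add_nonneg_nonneg)
    then have "0 < min (e s) (((resolvent i b - resolvent i a) / 2)\<^sup>2 / 2)"
      using lt by simp
    then obtain s' where s': "e s' < min (e s) (((resolvent i b - resolvent i a) / 2)\<^sup>2 / 2)"
      using approx_contact[OF tD] e_def by blast
    then have "(t - resolvent i s')\<^sup>2 < ((resolvent i b - resolvent i a) / 2)\<^sup>2"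
      using defect_nonneg[of s'] by (simp add: e_def)
    then have "\<bar>t - resolvent i s'\<bar> < (resolvent i b - resolvent i a) / 2"
      using lt by (metis abs_le_square_iff abs_of_pos half_gt_zero diff_gt_0_iff_gt not_le)
    then have "resolvent i a < resolvent i s'" "resolvent i s' < resolvent i b"
      by (auto simp: t_def abs_less_iff field_simps)
    then have "s' \<in> {a..b}"
      using resolvent_mono[of s' a i] resolvent_mono[of b s' i] by force
    from min[OF this] s' show False by simp
  qed
  then have zero: "defect s = 0" "resolvent i s = t"
    using defect_nonneg[of s] by (auto simp: e_def add_nonneg_eq_0_iff)
  have "a < s" "s < b" using s t zero(2) by (auto simp: less_le)
  then show ?thesis using zero(1) by blast
qed

text \<open>The sign \<open>d\<close> treats the two ends of the line together.\<close>

lemma zero_defect_beyond: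
  assumes d: "d = 1 \<or> d = - 1"
  shows "\<exists>s. r < d * s \<and> defect s = 0"
proof (rule ccontr)
  assume "\<not> ?thesis"
  then have no: "defect s \<noteq> 0" if "r < d * s" for s using that by blast
  have dd: "d * d = 1" using d by auto
  define b where "b = (\<lambda>i. resolvent i (d * (r + 1)))"
  have const: "resolvent i s = b i" if s: "r < d * s" for i s
  proof (rule ccontr)
    assume ne: "resolvent i s \<noteq> b i"
    define s' where "s' = d * (r + 1)"
    have s': "r < d * s'" using dd by (simp add: s'_def mult.assoc[symmetric])
    have "\<exists>u. min s s' < u \<and> u < max s s' \<and> defect u = 0"
    proof (cases "resolvent i s < resolvent i s'")
      case True
      from zero_defect_between[OF this] show ?thesis by auto
    next
      case False
      then have "resolvent i s' < resolvent i s" using ne by (simp add: b_def s'_def)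
      from zero_defect_between[OF this] show ?thesis by auto
    qed
    then obtain u where u: "min s s' < u" "u < max s s'" "defect u = 0" by blast
    have "r < d * u" using d s s' u by auto
    with no u show False by blast
  qed
  have bD: "b i \<in> D i" for i by (simp add: b_def resolvent_in_dom)
  have bound: "d * y \<le> d * b i" if y: "y \<in> D i" for i y
  proof (rule ccontr)
    assume "\<not> d * y \<le> d * b i"
    then have pos: "0 < d * (y - b i)" by (simp add: algebra_simps)
    \<comment> \<open>\<open>b i\<close> has the subgradients \<open>d * m - b i\<close> for all \<open>m > r\<close>; this \<open>m\<close> is too steep for \<open>y\<close>\<close>
    define m where "m = max (r + 1) (d * b i + (\<bar>\<phi> i y - \<phi> i (b i)\<bar> + 1) / (d * (y - b i)))"
    have "r < d * (d * m)" using dd by (simp add: m_def mult.assoc[symmetric])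
    from resolvent_subgradient[OF y, of "d * m", unfolded const[OF this]]
    have "\<phi> i (b i) + (d * m - b i) * (y - b i) \<le> \<phi> i y" .
    moreover have "(d * m - b i) * (y - b i) = (m - d * b i) * (d * (y - b i))"
      using d by (auto simp: algebra_simps)
    moreover have "(\<bar>\<phi> i y - \<phi> i (b i)\<bar> + 1) / (d * (y - b i)) \<le> m - d * b i"
      by (simp add: m_def)
    then have "\<bar>\<phi> i y - \<phi> i (b i)\<bar> + 1 \<le> (m - d * b i) * (d * (y - b i))"
      using pos by (simp add: pos_divide_le_eq)
    ultimately show False by linarith
  qed
  \<comment> \<open>with the other coordinates bounded in direction \<open>d\<close>, moving the \<open>i\<close>-th one past \<open>b i\<close> keeps the supremum finite\<close>
  fix i :: 'n
  have "b i + d \<in> D i \<and> \<phi> i (b i + d) \<le> \<phi> i (b i) + d * (\<Sum>j\<in>UNIV - {i}. b j)"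
  proof (rule least)
    fix x assume xi: "x i = b i + d" and x: "\<And>j. j \<noteq> i \<Longrightarrow> x j \<in> D j"
    have "pair_cost x = pair_cost (x(i := b i)) + d * (\<Sum>j\<in>UNIV - {i}. x j)"
      using pair_cost_upd[of x i "b i + d" "b i"] xi by (simp add: fun_upd_idem)
    moreover have "d * (\<Sum>j\<in>UNIV - {i}. x j) \<le> d * (\<Sum>j\<in>UNIV - {i}. b j)"
      unfolding sum_distrib_left by (intro sum_mono bound) (use x in auto)
    ultimately show "pair_cost x - (\<Sum>j\<in>UNIV - {i}. \<phi> j (x j))
        \<le> \<phi> i (b i) + d * (\<Sum>j\<in>UNIV - {i}. b j)"
      using affine_le[OF bD x] by fastforce
  qed
  then have "d * (b i + d) \<le> d * b i" using bound by blast
  then show False using dd by (simp add: distrib_left)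
qed

lemma zero_defect: "defect s = 0"
proof (rule ccontr)
  assume s: "defect s \<noteq> 0"
  have clZ: "closed {u. defect u = 0}"
    by (intro closed_Collect_eq continuous_defect) auto
  define L where "L = {u. defect u = 0} \<inter> {..s}"
  define U where "U = {u. defect u = 0} \<inter> {s..}"
  have "L \<noteq> {}" using zero_defect_beyond[of "-1" "-s"] by (force simp: L_def)
  moreover have Lbdd: "bdd_above L" unfolding L_def by (auto intro: bdd_aboveI)
  moreover have "closed L" unfolding L_def by (intro closed_Int clZ closed_atMost)
  ultimately have a: "Sup L \<in> L" by (rule closed_contains_Sup)
  have "U \<noteq> {}" using zero_defect_beyond[of 1 s] by (force simp: U_def)
  moreover have Ubdd: "bdd_below U" unfolding U_def by (auto intro: bdd_belowI)
  moreover have "closed U" unfolding U_def by (intro closed_Int clZ closed_atLeast)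
  ultimately have b: "Inf U \<in> U" by (rule closed_contains_Inf)
  have ab: "Sup L < s" "s < Inf U"
    using a b s by (auto simp: L_def U_def less_le)
  have none: "defect u \<noteq> 0" if u: "Sup L < u" "u < Inf U" for u
    using cSup_upper[OF _ Lbdd, of u] cInf_lower[OF _ Ubdd, of u] u
    by (cases "u \<le> s") (auto simp: L_def U_def)
  have "resolvent i (Sup L) = resolvent i (Inf U)" for i
    using zero_defect_between[of i "Sup L" "Inf U"] none resolvent_mono[of "Sup L" "Inf U" i] ab
    by force
  then have "(\<Sum>i\<in>UNIV. resolvent i (Sup L)) = (\<Sum>i\<in>UNIV. resolvent i (Inf U))" by simp
  moreover have "(\<Sum>i\<in>UNIV. resolvent i u) = u" if "defect u = 0" for u
    using that gap_resolvent_nonneg[of u] by (simp add: defect_def add_nonneg_eq_0_iff)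
  ultimately have "Sup L = Inf U" using a b by (simp add: L_def U_def)
  then show False using ab by simp
qed

lemma sum_resolvent: "(\<Sum>i\<in>UNIV. resolvent i s) = s"
  and gap_resolvent: "gap (\<lambda>i. resolvent i s) = 0"
  using zero_defect[of s] gap_resolvent_nonneg[of s]
  by (simp_all add: defect_def add_nonneg_eq_0_iff)

end


section \<open>Extended-real functions\<close>

text \<open>The points where the value is not \<open>\<infinity>\<close>, and the value there as a real number.\<close>

definition effective_domain :: "(real \<Rightarrow> ereal) \<Rightarrow> real set" where
  "effective_domain g = {t. g t \<noteq> \<infinity>}"

definition real_part :: "(real \<Rightarrow> ereal) \<Rightarrow> real \<Rightarrow> real" where
  "real_part g t = real_of_ereal (g t)"

lemma proper_eq_ereal:
  "proper_fun g \<Longrightarrow> t \<in> effective_domain g \<Longrightarrow> g t = ereal (real_part g t)"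
  by (cases "g t") (auto simp: proper_fun_def effective_domain_def real_part_def)

lemma not_in_effective_domain: "t \<notin> effective_domain g \<Longrightarrow> g t = \<infinity>"
  by (simp add: effective_domain_def)

lemma subdiff_iff:
  assumes g: "proper_fun g"
  shows "u \<in> subdiff g x \<longleftrightarrow> x \<in> effective_domain g \<and>
    (\<forall>y\<in>effective_domain g. real_part g x + u * (y - x) \<le> real_part g y)"
proof
  assume u: "u \<in> subdiff g x"
  obtain z where z: "z \<in> effective_domain g"
    using g by (auto simp: proper_fun_def effective_domain_def)
  have "g x + ereal (u * (z - x)) \<le> ereal (real_part g z)"
    using u proper_eq_ereal[OF g z] by (metis (mono_tags, lifting) mem_Collect_eq subdiff_def)
  then have x: "x \<in> effective_domain g" by (auto simp: effective_domain_def)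
  have "real_part g x + u * (y - x) \<le> real_part g y" if y: "y \<in> effective_domain g" for y
  proof -
    have "g x + ereal (u * (y - x)) \<le> g y" using u by (simp add: subdiff_def)
    then show ?thesis by (simp add: proper_eq_ereal[OF g x] proper_eq_ereal[OF g y])
  qed
  with x show "x \<in> effective_domain g \<and>
    (\<forall>y\<in>effective_domain g. real_part g x + u * (y - x) \<le> real_part g y)" by blast
next
  assume R: "x \<in> effective_domain g \<and>
    (\<forall>y\<in>effective_domain g. real_part g x + u * (y - x) \<le> real_part g y)"
  have "g x + ereal (u * (y - x)) \<le> g y" for y
  proof (cases "y \<in> effective_domain g")
    case True
    then show ?thesis using R by (simp add: proper_eq_ereal[OF g])
  next
    case False
    then show ?thesis by (simp add: not_in_effective_domain)
  qed
  then show "u \<in> subdiff g x" by (simp add: subdiff_def)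
qed

lemma Prox_eq_singleton:
  assumes g: "proper_fun g" and p: "s - p \<in> subdiff g p"
  shows "Prox g s = {p}"
proof -
  define h where "h = (\<lambda>y. g y + ereal (\<bar>s - y\<bar>\<^sup>2 / 2))"
  have pD: "p \<in> effective_domain g"
    and sub: "\<And>y. y \<in> effective_domain g \<Longrightarrow>
      real_part g p + (s - p) * (y - p) \<le> real_part g y"
    using p subdiff_iff[OF g] by auto
  have hD: "h y = ereal (real_part g y + (s - y)\<^sup>2 / 2)" if "y \<in> effective_domain g" for y
    using proper_eq_ereal[OF g that] by (simp add: h_def)
  have hN: "h y = \<infinity>" if "y \<notin> effective_domain g" for y
    using that by (simp add: h_def not_in_effective_domain)
  have growth: "real_part g p + (s - p)\<^sup>2 / 2 + (y - p)\<^sup>2 / 2 \<le> real_part g y + (s - y)\<^sup>2 / 2"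
    if "y \<in> effective_domain g" for y
    using sub[OF that] by (simp add: power2_eq_square field_simps)
  have "h p \<le> h y" for y
  proof (cases "y \<in> effective_domain g")
    case True
    have "real_part g p + (s - p)\<^sup>2 / 2 \<le> real_part g p + (s - p)\<^sup>2 / 2 + (y - p)\<^sup>2 / 2"
      by simp
    also note growth[OF True]
    finally show ?thesis using hD[OF pD] hD[OF True] by simp
  qed (simp add: hN)
  moreover have "y = p" if y: "h y \<le> h p" for y
  proof (cases "y \<in> effective_domain g")
    case True
    note growth[OF True]
    also have "real_part g y + (s - y)\<^sup>2 / 2 \<le> real_part g p + (s - p)\<^sup>2 / 2"
      using y hD[OF pD] hD[OF True] by simp
    finally have "(y - p)\<^sup>2 \<le> 0" by simp
    then show ?thesis by simp
  next
    case False
    then show ?thesis using y hN hD[OF pD] by simp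
  qed
  ultimately show ?thesis
    unfolding Prox_def is_arg_min_def h_def[symmetric] by (auto simp: not_less)
qed

lemma moreau_env_convex_conjugate:
  assumes g: "proper_fun g" and p: "s - p \<in> subdiff g p"
  shows "moreau_env (convex_conjugate g) s = ereal (s * p - real_part g p - p\<^sup>2 / 2)"
proof (rule antisym)
  have pD: "p \<in> effective_domain g"
    and sub: "\<And>y. y \<in> effective_domain g \<Longrightarrow>
      real_part g p + (s - p) * (y - p) \<le> real_part g y"
    using p subdiff_iff[OF g] by auto
  have "convex_conjugate g (s - p) \<le> ereal ((s - p) * p - real_part g p)"
    unfolding convex_conjugate_def
  proof (rule SUP_least)
    fix x
    show "ereal (x * (s - p)) - g x \<le> ereal ((s - p) * p - real_part g p)"
    proof (cases "x \<in> effective_domain g")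
      case True
      then show ?thesis
        using sub[OF True] by (simp add: proper_eq_ereal[OF g] algebra_simps)
    qed (simp add: not_in_effective_domain)
  qed
  then have "convex_conjugate g (s - p) + ereal (q (s - (s - p)))
      \<le> ereal ((s - p) * p - real_part g p) + ereal (q (s - (s - p)))"
    by (rule add_right_mono)
  also have "\<dots> = ereal (s * p - real_part g p - p\<^sup>2 / 2)"
    by (simp add: q_def power2_eq_square field_simps)
  finally show "moreau_env (convex_conjugate g) s \<le> ereal (s * p - real_part g p - p\<^sup>2 / 2)"
    unfolding moreau_env_def by (rule INF_lower2[OF UNIV_I])
  show "ereal (s * p - real_part g p - p\<^sup>2 / 2) \<le> moreau_env (convex_conjugate g) s"
    unfolding moreau_env_def
  proof (rule INF_greatest)
    fix y
    have "0 \<le> (s - y - p)\<^sup>2" by simp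
    then have "ereal (s * p - real_part g p - p\<^sup>2 / 2)
        \<le> ereal (p * y - real_part g p) + ereal (q (s - y))"
      by (simp add: q_def power2_eq_square field_simps)
    also have "ereal (p * y - real_part g p) = ereal (p * y) - g p"
      by (simp add: proper_eq_ereal[OF g pD])
    also have "\<dots> \<le> convex_conjugate g y"
      unfolding convex_conjugate_def by (rule SUP_upper) simp
    finally show "ereal (s * p - real_part g p - p\<^sup>2 / 2) \<le> convex_conjugate g y + ereal (q (s - y))"
      by (simp add: add_right_mono)
  qed
qed

text \<open>The easy half of Minty's theorem: a monotone map with surjective \<open>Id + A\<close> is maximal.\<close>

lemma maximally_monotone_subdiff:
  assumes g: "proper_fun g" and surj: "\<And>s. \<exists>p. s - p \<in> subdiff g p"
  shows "maximally_monotone (subdiff g)"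
  unfolding maximally_monotone_def
proof (intro conjI allI impI)
  show "monotone_map (subdiff g)"
    unfolding monotone_map_def
  proof (intro allI ballI)
    fix x y u v assume u: "u \<in> subdiff g x" and v: "v \<in> subdiff g y"
    have "real_part g x + u * (y - x) \<le> real_part g y" "real_part g y + v * (x - y) \<le> real_part g x"
      using u v unfolding subdiff_iff[OF g] by auto
    then show "0 \<le> (x - y) * (u - v)" by (simp add: algebra_simps)
  qed
  fix B assume B: "monotone_map B \<and> (\<forall>x. subdiff g x \<subseteq> B x)"
  have "u \<in> subdiff g x" if u: "u \<in> B x" for u x
  proof -
    obtain p where p: "x + u - p \<in> subdiff g p" using surj by blast
    then have "x + u - p \<in> B p" using B by blast
    then have "0 \<le> (x - p) * (u - (x + u - p))" using B u unfolding monotone_map_def by blast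
    also have "\<dots> = - (x - p)\<^sup>2" by (simp add: power2_eq_square algebra_simps)
    finally have "p = x" by simp
    then show ?thesis using p by simp
  qed
  then show "B = subdiff g" using B by (intro ext) blast
qed

section \<open>Consequences for conjugate tuples\<close>

lemma cost_eq_pair_cost:
  fixes x :: "real ^ ('n :: {finite, linorder})"
  shows "cost x = pair_cost (\<lambda>i. x $ i)"
proof -
  let ?h = "\<lambda>(i, j). x $ i * x $ j"
  have "(\<Sum>i\<in>UNIV. x $ i)\<^sup>2 = sum ?h (UNIV \<times> UNIV)"
    by (simp only: power2_eq_square sum_product sum.cartesian_product)
  also have "(UNIV :: 'n set) \<times> (UNIV :: 'n set) = {(i, j). i < j} \<union> ({(i, j). j < i} \<union> {(i, j). i = j})"
    by auto
  also have "sum ?h ({(i, j). i < j} \<union> ({(i, j). j < i} \<union> {(i, j). i = j})) = sum ?h {(i, j). i < j} + (sum ?h {(i, j). j < i} + sum ?h {(i, j). i = j})"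
    by (subst sum.union_disjoint, simp, simp, force, subst sum.union_disjoint) auto
  also have "sum ?h {(i, j). j < i} = cost x"
    unfolding cost_def
    by (rule sum.reindex_bij_witness[of _ prod.swap prod.swap]) (auto simp: mult.commute)
  also have "sum ?h {(i, j). i = j} = (\<Sum>i\<in>UNIV. (x $ i)\<^sup>2)"
    by (rule sum.reindex_bij_witness[of _ "\<lambda>i. (i, i)" fst]) (auto simp: power2_eq_square)
  finally show ?thesis by (simp add: pair_cost_def cost_def)
qed

lemma sum_eq_ereal:
  assumes f: "\<And>i. proper_fun (f i)" and x: "\<And>j. j \<in> S \<Longrightarrow> x j \<in> effective_domain (f j)"
  shows "(\<Sum>j\<in>S. f j (x j)) = ereal (\<Sum>j\<in>S. real_part (f j) (x j))"
proof -
  have "(\<Sum>j\<in>S. f j (x j)) = (\<Sum>j\<in>S. ereal (real_part (f j) (x j)))"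
    by (intro sum.cong refl proper_eq_ereal f x)
  then show ?thesis by simp
qed

lemma conjugate_tuple_real_part:
  fixes f :: "'n :: {finite, linorder} \<Rightarrow> real \<Rightarrow> ereal"
  assumes "c_conjugate_tuple f"
  shows "conjugate_tuple (\<lambda>i. effective_domain (f i)) (\<lambda>i. real_part (f i))"
proof -
  have f: "\<And>i. proper_fun (f i)" and conj: "\<And>i t. f i t = c_conjugate f i t"
    using assms by (auto simp: c_conjugate_tuple_def)
  show ?thesis
  proof
    fix i :: 'n
    show "effective_domain (f i) \<noteq> {}"
      using f[of i] by (auto simp: proper_fun_def effective_domain_def)
  next
    fix x :: "'n \<Rightarrow> real" assume x: "\<And>i. x i \<in> effective_domain (f i)"
    fix i :: 'n
    define v :: "(real, 'n) vec" where "v = (\<chi> j. x j)"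
    have "ereal (cost v) - (\<Sum>j\<in>UNIV - {i}. f j (v $ j)) \<le> f i (x i)"
      unfolding conj[of i] c_conjugate_def by (rule SUP_upper) (simp add: v_def)
    then have "ereal (pair_cost x - (\<Sum>j\<in>UNIV - {i}. real_part (f j) (x j)))
        \<le> ereal (real_part (f i) (x i))"
      using sum_eq_ereal[where f = f and x = x and S = "UNIV - {i}"] f x
      by (simp add: v_def cost_eq_pair_cost proper_eq_ereal[OF f x])
    then show "pair_cost x \<le> (\<Sum>i\<in>UNIV. real_part (f i) (x i))"
      by (subst sum.remove[of _ i]) auto
  next
    fix i :: 'n and t r
    assume le: "\<And>x. x i = t \<Longrightarrow> (\<And>j. j \<noteq> i \<Longrightarrow> x j \<in> effective_domain (f j)) \<Longrightarrow>
      pair_cost x - (\<Sum>j\<in>UNIV - {i}. real_part (f j) (x j)) \<le> r"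
    have "f i t \<le> ereal r"
      unfolding conj[of i] c_conjugate_def
    proof (rule SUP_least)
      fix v :: "(real, 'n) vec" assume v: "v \<in> {x. x $ i = t}"
      show "ereal (cost v) - (\<Sum>j\<in>UNIV - {i}. f j (v $ j)) \<le> ereal r"
      proof (cases "\<forall>j\<in>UNIV - {i}. v $ j \<in> effective_domain (f j)")
        case True
        then show ?thesis
          using le[of "\<lambda>j. v $ j"] v sum_eq_ereal[where f = f and x = "\<lambda>j. v $ j" and S = "UNIV - {i}"] f
          by (simp add: cost_eq_pair_cost)
      next
        case False
        then have "\<exists>j\<in>UNIV - {i}. f j (v $ j) = \<infinity>" using not_in_effective_domain by blast
        then have "(\<Sum>j\<in>UNIV - {i}. f j (v $ j)) = \<infinity>" by (simp add: sum_Pinfty)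
        then show ?thesis by simp
      qed
    qed
    moreover from this have "t \<in> effective_domain (f i)" by (auto simp: effective_domain_def)
    ultimately show "t \<in> effective_domain (f i) \<and> real_part (f i) t \<le> r"
      using proper_eq_ereal[OF f, of t i] by simp
  qed
qed

lemma sum_singletons:
  fixes g :: "'i \<Rightarrow> 'a :: comm_monoid_add"
  assumes "finite S"
  shows "(\<Sum>i\<in>S. {g i}) = {\<Sum>i\<in>S. g i}"
  using assms by (induction S rule: finite_induct) (auto simp: set_zero set_plus_def)

theorem theorem1p5:
  fixes f :: "'n :: {finite, linorder} \<Rightarrow> real \<Rightarrow> ereal"
    and \<Gamma> :: "(real ^ ('n :: {finite, linorder})) set"
  assumes N: "CARD('n) \<ge> 2"
    and A: "\<And>i. f i \<in> class_A"
    and conj: "c_conjugate_tuple f"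
    and \<Gamma>: "\<Gamma> = contact_set f"
  shows "(\<exists>i\<^sub>0. maximally_monotone (marginal_map \<Gamma> i\<^sub>0)) \<and>
    (\<exists>i\<^sub>0. marginal_map \<Gamma> i\<^sub>0 = subdiff (f i\<^sub>0)) \<and>
    (\<forall>i. marginal_map \<Gamma> i = subdiff (f i)) \<and>
    (\<forall>x. (\<Sum>i\<in>UNIV. Prox (f i) x) = {x}) \<and>
    (\<forall>x. (\<Sum>i\<in>UNIV. moreau_env (convex_conjugate (f i)) x) = ereal (q x)) \<and>
    \<Gamma> + diagonal\<^sup>\<bottom> = UNIV \<and>
    sum_set \<Gamma> = UNIV"
proof -
  interpret conjugate_tuple "\<lambda>i. effective_domain (f i)" "\<lambda>i. real_part (f i)"
    by (rule conjugate_tuple_real_part[OF conj])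
  have f: "proper_fun (f i)" for i using conj by (simp add: c_conjugate_tuple_def)
  define P :: "real \<Rightarrow> (real, 'n) vec" where "P s = (\<chi> i. resolvent i s)" for s
  have P_subdiff: "s - P s $ i \<in> subdiff (f i) (P s $ i)" for s i
    unfolding subdiff_iff[OF f] using resolvent_in_dom resolvent_subgradient by (simp add: P_def)
  have P_unique: "P (x + u) $ i = x" if "u \<in> subdiff (f i) x" for x u i
    using that resolvent_eqI[of x i "x + u"] unfolding subdiff_iff[OF f] by (simp add: P_def)
  have P_sum: "(\<Sum>i\<in>UNIV. P s $ i) = s" for s
    using sum_resolvent by (simp add: P_def)
  have P_cost: "(\<Sum>i\<in>UNIV. real_part (f i) (P s $ i)) = cost (P s)" for s
    using gap_resolvent[of s] by (simp add: gap_def P_def cost_eq_pair_cost)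
  have P_\<Gamma>: "P s \<in> \<Gamma>" for s
    using sum_eq_ereal[where f = f and x = "\<lambda>i. P s $ i" and S = UNIV] f P_cost[of s]
    by (simp add: \<Gamma> contact_set_def P_def resolvent_in_dom)

  have marginal: "marginal_map \<Gamma> i = subdiff (f i)" for i
  proof (intro ext set_eqI iffI)
    fix t u assume "u \<in> marginal_map \<Gamma> i t"
    then obtain x where x: "x \<in> \<Gamma>" "x $ i = t" and u: "u = (\<Sum>j\<in>UNIV - {i}. x $ j)"
      by (auto simp: marginal_map_def)
    have eq: "(\<Sum>j\<in>UNIV. f j (x $ j)) = ereal (cost x)" using x by (simp add: \<Gamma> contact_set_def)
    have xD: "x $ j \<in> effective_domain (f j)" for j
    proof (rule ccontr)
      assume "x $ j \<notin> effective_domain (f j)"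
      then have "f j (x $ j) = \<infinity>" by (rule not_in_effective_domain)
      then have "(\<Sum>j\<in>UNIV. f j (x $ j)) = \<infinity>" by (auto simp: sum_Pinfty)
      then show False using eq by simp
    qed
    have "(\<Sum>j\<in>UNIV. real_part (f j) (x $ j)) = pair_cost (\<lambda>j. x $ j)"
      using eq sum_eq_ereal[where f = f and x = "\<lambda>j. x $ j" and S = UNIV] f xD
      by (simp add: cost_eq_pair_cost)
    then have tot: "real_part (f i) t + (\<Sum>j\<in>UNIV - {i}. real_part (f j) (x $ j)) = pair_cost (\<lambda>j. x $ j)"
      using x(2) by (subst (asm) sum.remove[of _ i]) auto
    have "real_part (f i) t + u * (y - t) \<le> real_part (f i) y" if y: "y \<in> effective_domain (f i)" for y
      using affine_le[OF y xD] tot pair_cost_upd[of "\<lambda>j. x $ j" i y t] x(2)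
      by (simp add: u fun_upd_idem mult.commute)
    then show "u \<in> subdiff (f i) t"
      unfolding subdiff_iff[OF f] using xD[of i] x(2) by simp
  next
    fix t u assume u: "u \<in> subdiff (f i) t"
    have "(\<Sum>j\<in>UNIV - {i}. P (t + u) $ j) = u"
      using P_sum[of "t + u"] P_unique[OF u] by (subst (asm) sum.remove[of _ i]) auto
    then show "u \<in> marginal_map \<Gamma> i t"
      unfolding marginal_map_def mem_Collect_eq
      using P_\<Gamma>[of "t + u"] P_unique[OF u] by (intro exI[of _ "P (t + u)"]) simp
  qed

  have maxmon: "maximally_monotone (subdiff (f i))" for i
    by (rule maximally_monotone_subdiff[OF f]) (use P_subdiff in blast)

  have prox: "(\<Sum>i\<in>UNIV. Prox (f i) x) = {x}" for x
    using Prox_eq_singleton[OF f P_subdiff] by (simp add: sum_singletons P_sum)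

  have env: "(\<Sum>i\<in>UNIV. moreau_env (convex_conjugate (f i)) x) = ereal (q x)" for x
  proof -
    have "(\<Sum>i\<in>UNIV. moreau_env (convex_conjugate (f i)) x)
        = ereal (\<Sum>i\<in>UNIV. x * P x $ i - real_part (f i) (P x $ i) - (P x $ i)\<^sup>2 / 2)"
      using moreau_env_convex_conjugate[OF f P_subdiff] by simp
    also have "(\<Sum>i\<in>UNIV. x * P x $ i - real_part (f i) (P x $ i) - (P x $ i)\<^sup>2 / 2)
        = x * x - cost (P x) - (\<Sum>i\<in>UNIV. (P x $ i)\<^sup>2) / 2"
      by (simp add: sum_subtractf P_sum P_cost flip: sum_distrib_left sum_divide_distrib)
    also have "\<dots> = q x"
      by (simp add: cost_eq_pair_cost pair_cost_def P_sum q_def power2_eq_square field_simps)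
    finally show ?thesis .
  qed

  have "v \<in> \<Gamma> + diagonal\<^sup>\<bottom>" for v :: "(real, 'n) vec"
  proof -
    let ?s = "\<Sum>i\<in>UNIV. v $ i"
    have "(\<Sum>i\<in>UNIV. (v - P ?s) $ i) = 0" by (simp add: sum_subtractf P_sum)
    \<comment> \<open>orthogonality to the diagonal means that the coordinates sum to zero\<close>
    then have "v - P ?s \<in> diagonal\<^sup>\<bottom>"
      by (auto simp: orthogonal_comp_def diagonal_def orthogonal_def inner_vec_def
          simp flip: sum_distrib_left)
    from set_plus_intro[OF P_\<Gamma>[of ?s] this] show ?thesis by simp
  qed
  moreover have "s \<in> sum_set \<Gamma>" for s
    unfolding sum_set_def mem_Collect_eq
    using P_\<Gamma>[of s] P_sum[of s] by (intro exI[of _ "P s"]) simp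
  ultimately show ?thesis using marginal maxmon prox env by auto
qed

end
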